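(* There is an absolute constant $K$ such that the following holds. Let $k,n,d$ be positive integers with $k\ge2$ and $n\ge d$. If $\mathcal{F}\subset[k]^n$ does not contain a $d$-dimensional Boolean algebra, then $|\mathcal{F}|\le K\,k^{\,n-1/2^{d-1}}\,n^{-1/2^{d}}$. In particular, $b(n,d)\le K\,2^n n^{-1/2^d}$.
   Context: $[k]^n=\{1,\dots,k\}^n$. Two vectors $\mathbf v,\mathbf w\in\{0,1,\dots,k-1\}^n$ are disjoint if for every $i\in[n]$ at most one of $\mathbf v(i),\mathbf w(i)$ is nonzero. A set $B\subset[k]^n$ is a $d$-dimensional Boolean algebra if there exist $\mathbf v_0\in[k]^n$ and nonzero, pairwise disjoint $\mathbf v_1,\dots,\mathbf v_d\in\{0,\dots,k-1\}^n$ such that $B=\{\mathbf v_0+\sum_{i\in I}\mathbf v_i: I\subset[d]\}$. In $2^{[n]}$, a $d$-dimensional Boolean algebra is a set of the form $\{X_0\cup\bigcup_{i\in I}X_i: I\subset[d]\}$ with $X_0,X_1,\dots,X_d\subset[n]$ pairwise disjoint and $X_1,\dots,X_d$ nonempty (equivalently, a Boolean algebra in $[2]^n$ under the natural identification). $b(n,d)$ is the maximum size of a family in $2^{[n]}$ containing no $d$-dimensional Boolean algebra. *)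

theory Defs
  imports "HOL-Analysis.Analysis"
begin

definition cube :: "nat \<Rightarrow> nat \<Rightarrow> (nat \<Rightarrow> nat) set" where
  "cube k n = {v. (\<forall>i<n. v i \<in> {1..k}) \<and> (\<forall>i\<ge>n. v i = 0)}"

definition dirs :: "nat \<Rightarrow> nat \<Rightarrow> (nat \<Rightarrow> nat) set" where
  "dirs k n = {v. (\<forall>i<n. v i < k) \<and> (\<forall>i\<ge>n. v i = 0)}"

definition disjoint_vec :: "(nat \<Rightarrow> nat) \<Rightarrow> (nat \<Rightarrow> nat) \<Rightarrow> bool" where
  "disjoint_vec v w \<longleftrightarrow> (\<forall>i. v i = 0 \<or> w i = 0)"

definition bool_alg :: "nat \<Rightarrow> nat \<Rightarrow> nat \<Rightarrow> (nat \<Rightarrow> nat) set \<Rightarrow> bool" where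
  "bool_alg k n d B \<longleftrightarrow> B \<subseteq> cube k n \<and>
     (\<exists>v0 vs. v0 \<in> cube k n \<and>
        (\<forall>i\<in>{1..d}. vs i \<in> dirs k n \<and> vs i \<noteq> (\<lambda>_. 0)) \<and>
        (\<forall>i\<in>{1..d}. \<forall>j\<in>{1..d}. i \<noteq> j \<longrightarrow> disjoint_vec (vs i) (vs j)) \<and>
        B = {(\<lambda>x. v0 x + (\<Sum>i\<in>I. vs i x)) | I. I \<subseteq> {1..d}})"

definition set_bool_alg :: "nat \<Rightarrow> nat \<Rightarrow> nat set set \<Rightarrow> bool" where
  "set_bool_alg n d B \<longleftrightarrow>
     (\<exists>X :: nat \<Rightarrow> nat set. (\<forall>i\<in>{0..d}. X i \<subseteq> {0..<n}) \<and>
        (\<forall>i\<in>{1..d}. X i \<noteq> {}) \<and>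
        (\<forall>i\<in>{0..d}. \<forall>j\<in>{0..d}. i \<noteq> j \<longrightarrow> X i \<inter> X j = {}) \<and>
        B = {X 0 \<union> (\<Union>i\<in>I. X i) | I. I \<subseteq> {1..d}})"

definition b :: "nat \<Rightarrow> nat \<Rightarrow> nat" where
  "b n d = Max {card F | F. F \<subseteq> Pow {0..<n} \<and> \<not> (\<exists>B\<subseteq>F. set_bool_alg n d B)}"

end

theory Submission
  imports Defs "HOL-Computational_Algebra.Polynomial" "HOL-Library.Disjoint_Sets"
begin

text \<open>
  Split the coordinates as \<open>I \<union> J\<close> and partition \<open>[k]\<^sup>I\<close> into few chains.
  For two comparable points \<open>c < c'\<close> of one chain, the set of \<open>x \<in> [k]\<^sup>J\<close> with
  \<open>(c, x), (c', x) \<in> F\<close> contains no \<open>d\<close>-dimensional algebra if \<open>F\<close> contains no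
  \<open>(d + 1)\<close>-dimensional one, since \<open>c' - c\<close> would supply the missing direction. Counting such
  pairs with Cauchy--Schwarz bounds the maximal density by
  \<open>\<delta>\<^bsub>d+1\<^esub>(I \<union> J) \<le> w(I) + sqrt (\<delta>\<^bsub>d\<^esub>(J))\<close>, where \<open>w(I)\<close> is the number of chains divided
  by \<open>k\<^bsup>|I|\<^esup>\<close>. A symmetric chain decomposition has as many chains as the middle layer of
  \<open>[k]\<^sup>I\<close> has elements, which gives \<open>w(I) \<le> 4 (k\<^sup>2 |I|)\<^bsup>-1/2\<^esup>\<close>; the induction on \<open>d\<close>
  starts from \<open>\<delta>\<^sub>0 = 0\<close>.
\<close>

section \<open>The size of a layer\<close>

text \<open>Induction on the ratio of consecutive central binomials,
  \<open>2*(2*j+1) / (j+1)\<close>. The weight \<open>2*j+1\<close> is chosen so that the step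
  reduces to \<open>(2*j+1) * (2*j+3) \<le> 4 * (j+1)^2\<close>.\<close>

lemma central_binomial_even:
  "(2*j+1) * (2*j choose j)^2 \<le> 16^j" for j :: nat
proof (induction j)
  case (Suc j)
  define c where "c = (2*j choose j)"
  define c' where "c' = (2*Suc j choose Suc j)"
  have "Suc j * c' = Suc (2*j+1) * (2*j+1 choose j)"
    unfolding c'_def using Suc_times_binomial[of j "2*j+1"] by simp
  also have "\<dots> = Suc j * (2 * (2*j+1 choose j))"
    by (simp add: algebra_simps)
  finally have "c' = 2 * (2*j+1 choose j)"
    by (simp only: Suc_mult_cancel1)
  moreover have "(2*j+1 choose j) = (Suc (2*j) choose Suc j)"
    using binomial_symmetric[of j "2*j+1"] by simp
  moreover have "Suc j * (Suc (2*j) choose Suc j) = Suc (2*j) * c"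
    unfolding c_def by (rule Suc_times_binomial)
  ultimately have rec: "(j+1) * c' = 2 * (2*j+1) * c"
    by (simp del: binomial_Suc_Suc)
  have "(j+1)^2 * ((2*j+3) * c'^2) = (2*j+3) * ((j+1)*c')^2"
    by (simp only: power_mult_distrib mult_ac)
  also have "\<dots> = (4 * (2*j+1) * (2*j+3)) * ((2*j+1) * c^2)"
    unfolding rec by (simp add: power2_eq_square algebra_simps)
  also have "\<dots> \<le> (16 * (j+1)^2) * 16^j"
    by (rule mult_mono) (use Suc in \<open>auto simp: c_def power2_eq_square algebra_simps\<close>)
  finally have "(j+1)^2 * ((2*j+3) * c'^2) \<le> (j+1)^2 * 16^Suc j"
    by (simp add: mult_ac)
  hence "(2*j+3) * c'^2 \<le> 16^Suc j"
    by (subst (asm) mult_le_cancel1) simp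
  thus ?case by (simp add: c'_def del: binomial_Suc_Suc power_Suc) (simp add: algebra_simps numeral_eq_Suc)
qed simp

text \<open>An odd row \<open>2*j+1\<close> has two equal middle entries, which add up to the
  central entry of row \<open>2*j+2\<close>; the even case thus gives the odd one.\<close>

lemma central_binomial_upper_bound:
  "(m+1) * (m choose (m div 2))^2 \<le> 4^m" for m :: nat
proof (cases "even m")
  case True
  then obtain j where "m = 2*j" by blast
  thus ?thesis using central_binomial_even[of j] by (simp add: power_mult)
next
  case False
  then obtain j where m: "m = 2*j+1" by (auto elim: oddE)
  have "(2*Suc j choose Suc j) = (2*j+1 choose j) + (2*j+1 choose Suc j)"
    by simp
  moreover have "(2*j+1 choose Suc j) = (2*j+1 choose j)"
    using binomial_symmetric[of j "2*j+1"] by simp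
  ultimately have "(2*Suc j choose Suc j) = 2 * (2*j+1 choose j)" by simp
  hence "(2*Suc j+1) * (2 * (2*j+1 choose j))^2 \<le> 16^Suc j"
    using central_binomial_even[of "Suc j"] by metis
  hence "(2*j+3) * (2*j+1 choose j)^2 \<le> 4 * 16^j"
    by (simp add: power_mult_distrib algebra_simps)
  moreover have "(2*j+2) * (2*j+1 choose j)^2 \<le> (2*j+3) * (2*j+1 choose j)^2"
    by (rule mult_right_mono) auto
  ultimately have "(2*j+2) * (2*j+1 choose j)^2 \<le> 4 * 16^j" by linarith
  thus ?thesis by (simp add: m power_mult)
qed

text \<open>Generating polynomial of one coordinate: the \<open>s\<close>-th coefficient of
  \<open>gpoly k ^ n\<close> counts the points with entries in \<open>0..k-1\<close> and sum
  \<open>s\<close>, a layer of the cube after a shift by 1.\<close>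

definition gpoly :: "nat \<Rightarrow> nat poly" where
  "gpoly h = (\<Sum>x<h. monom 1 x)"

lemma coeff_gpoly: "coeff (gpoly h) s = (if s < h then 1 else 0)"
  by (simp add: gpoly_def coeff_sum)

lemma poly_gpoly_1: "poly (gpoly h) 1 = h"
  by (simp add: gpoly_def poly_sum poly_monom)

text \<open>Natural coefficients are nonnegative, so \<open>poly q 1\<close> is the total weight
  with which the convolution combines coefficients of \<open>p\<close>.\<close>

lemma coeff_mult_le:
  fixes p q :: "nat poly"
  assumes "\<And>i. coeff p i \<le> c"
  shows "coeff (p * q) s \<le> c * poly q 1"
proof -
  have "coeff (p * q) s \<le> (\<Sum>i\<le>s. c * coeff q (s - i))"
    unfolding coeff_mult by (intro sum_mono mult_right_mono assms) auto
  also have "\<dots> = c * (\<Sum>i\<le>s. coeff q i)"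
    by (subst sum.atLeastAtMost_rev[of _ 0 s, simplified atMost_atLeast0[symmetric]])
       (simp add: sum_distrib_left atMost_atLeast0)
  also have "(\<Sum>i\<le>s. coeff q i) = (\<Sum>i\<in>{..s} \<inter> {..degree q}. coeff q i)"
    by (rule sum.mono_neutral_right) (auto intro: le_degree)
  also have "\<dots> \<le> (\<Sum>i\<le>degree q. coeff q i)"
    by (rule sum_mono2) auto
  also have "\<dots> = poly q 1" by (simp add: poly_altdef)
  finally show ?thesis by simp
qed

text \<open>The coefficients of \<open>(1 + X^h)^m\<close> are binomials placed at multiples of
  \<open>h\<close>; the factor \<open>gpoly h\<close> spreads each over a window of length
  \<open>h\<close>, and these windows tile the exponents. The induction step is Pascal's
  rule.\<close>

lemma coeff_gpoly_mult_binomial: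
  assumes "h \<ge> 1"
  shows "coeff (gpoly h * (1 + monom 1 h)^m) s = (m choose (s div h))"
proof (induction m arbitrary: s)
  case 0
  show ?case using assms by (simp add: coeff_gpoly div_eq_0_iff div_greater_zero_iff)
next
  case (Suc m)
  have eq: "gpoly h * (1 + monom 1 h)^Suc m
      = gpoly h * (1 + monom 1 h)^m + monom 1 h * (gpoly h * (1 + monom 1 h)^m)"
    by (simp add: algebra_simps)
  have "coeff (gpoly h * (1 + monom 1 h)^Suc m) s
      = (m choose (s div h)) + (if h \<le> s then m choose ((s - h) div h) else 0)"
    unfolding eq coeff_add Suc coeff_monom_mult by auto
  thus ?case using assms by (auto simp: le_div_geq)
qed

text \<open>
  Pairing \<open>x\<close> with \<open>x + h\<close>, where \<open>h\<close> is about \<open>k / 2\<close>, turns the distribution of a coordinate sum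
  into a mixture of binomial distributions of step \<open>h\<close>; averaging over \<open>h\<close> consecutive values
  then leaves only a single binomial coefficient.
\<close>

lemma gpoly_split:
  assumes "e \<le> 1"
  shows "gpoly (2*h + e) = gpoly h * (1 + monom 1 h) + monom e (2*h)"
proof (rule poly_eqI)
  fix s
  have "gpoly h * (1 + monom 1 h) = gpoly h + monom 1 h * gpoly h"
    by (simp add: algebra_simps)
  thus "coeff (gpoly (2*h+e)) s = coeff (gpoly h * (1 + monom 1 h) + monom e (2*h)) s"
    using assms by (auto simp: coeff_gpoly coeff_monom_mult)
qed

text \<open>Expand the power of the split polynomial by the binomial theorem. In the
  \<open>j\<close>-th term the extra factor \<open>gpoly h\<close> joins \<open>(1 + X^h)^j\<close>,
  whose coefficients become at most central binomials; all other factors cost only their value at 1.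
  For \<open>e = 0\<close> only \<open>j = n\<close> survives, since \<open>0^0 = 1\<close>.\<close>

lemma coeff_gpoly_mult_gpoly_power:
  assumes "h \<ge> 1" "e \<le> 1"
  shows "coeff (gpoly h * gpoly (2*h+e)^n) s
    \<le> (\<Sum>j\<le>n. (n choose j) * (j choose (j div 2)) * h^j * e^(n-j))"
proof -
  let ?a = "gpoly h * (1 + monom 1 h)" and ?b = "monom e (2*h)"
  have "gpoly h * gpoly (2*h+e)^n = (\<Sum>j\<le>n. gpoly h * (of_nat (n choose j) * ?a^j * ?b^(n-j)))"
    unfolding gpoly_split[OF assms(2)] binomial_ring sum_distrib_left ..
  also have "\<dots> = (\<Sum>j\<le>n. (gpoly h * (1 + monom 1 h)^j) * (of_nat (n choose j) * gpoly h^j * ?b^(n-j)))"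
    by (rule sum.cong) (simp_all only: power_mult_distrib mult_ac)
  finally have eq: "coeff (gpoly h * gpoly (2*h+e)^n) s = (\<Sum>j\<le>n.
      coeff ((gpoly h * (1 + monom 1 h)^j) * (of_nat (n choose j) * gpoly h^j * ?b^(n-j))) s)"
    by (simp add: coeff_sum)
  have le: "coeff ((gpoly h * (1 + monom 1 h)^j) * (of_nat (n choose j) * gpoly h^j * ?b^(n-j))) s
      \<le> (j choose (j div 2)) * poly (of_nat (n choose j) * gpoly h^j * ?b^(n-j)) 1" for j
    by (rule coeff_mult_le) (simp only: coeff_gpoly_mult_binomial[OF assms(1)] binomial_maximum)
  have val: "poly (of_nat (n choose j) * gpoly h^j * ?b^(n-j)) 1 = (n choose j) * h^j * e^(n-j)" for j
    by (simp add: poly_power poly_gpoly_1 poly_monom of_nat_poly del: One_nat_def)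
  show ?thesis unfolding eq
    by (intro sum_mono order_trans[OF le]) (simp only: val, simp only: mult_ac order_refl)
qed

text \<open>With \<open>w\<close> the terms of the expansion of \<open>(2*h+e)^n\<close> and
  \<open>u j\<close> the normalised central binomial, \<open>S\<close> is the sum of
  \<open>w j * u j\<close>. Cauchy-Schwarz with weight \<open>w\<close> and
  \<open>(u j)^2 \<le> 1/(j+1)\<close> leave the sum of \<open>w j / (j+1)\<close>; absorbing
  \<open>j+1\<close> into the binomial coefficient turns it into part of the expansion of
  \<open>(2*h+e)^(n+1)\<close>.\<close>

lemma weighted_central_binomial_sum:
  fixes h e n :: nat
  assumes "h \<ge> 1"
  defines "S \<equiv> (\<Sum>j\<le>n. (n choose j) * (j choose (j div 2)) * h^j * e^(n-j))"
  shows "real S ^ 2 * (real (n+1) * (2*h)) \<le> real (2*h+e) ^ (2*n+1)"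
proof -
  define w where "w j = real (n choose j) * (2*h)^j * e^(n-j)" for j
  define u where "u j = real (j choose (j div 2)) / 2^j" for j
  have w0: "w j \<ge> 0" for j by (simp add: w_def)
  have "real S = (\<Sum>j\<le>n. sqrt (w j) * (sqrt (w j) * u j))"
    unfolding S_def of_nat_sum
    by (rule sum.cong) (use w0 in \<open>auto simp: w_def u_def power_mult_distrib simp flip: mult.assoc\<close>)
  hence "real S ^ 2 \<le> (\<Sum>j\<le>n. (sqrt (w j))^2) * (\<Sum>j\<le>n. (sqrt (w j) * u j)^2)"
    using Cauchy_Schwarz_ineq_sum by metis
  also have "\<dots> = (\<Sum>j\<le>n. w j) * (\<Sum>j\<le>n. w j * (u j)^2)"
    using w0 by (simp add: power_mult_distrib)
  also have "(\<Sum>j\<le>n. w j) = real (2*h+e)^n"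
    unfolding w_def using binomial_ring[of "2*real h" "real e" n] by simp
  finally have 1: "real S ^ 2 \<le> real (2*h+e)^n * (\<Sum>j\<le>n. w j * (u j)^2)" .
  have u2: "(u j)^2 \<le> 1 / real (j+1)" for j
  proof -
    have "real ((j+1) * (j choose (j div 2))^2) \<le> real (4^j)"
      using central_binomial_upper_bound[of j] of_nat_le_iff by blast
    thus ?thesis by (simp add: u_def field_simps flip: power_mult)
      (simp add: power2_eq_square power_mult mult.commute[of j])
  qed
  have wj: "w j * (1 / real (j+1)) * (real (n+1) * (2*h))
      = real (Suc n choose Suc j) * (2 * real h)^Suc j * e^(Suc n - Suc j)" for j
  proof -
    have "(n choose j) * (n+1) = (Suc n choose Suc j) * (j+1)"
      using Suc_times_binomial[of j n] by (simp only: mult_ac Suc_eq_plus1)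
    hence "real (n choose j) * real (n+1) = real (Suc n choose Suc j) * real (j+1)"
      by (simp only: flip: of_nat_mult)
    moreover have "w j * (1 / real (j+1)) * (real (n+1) * (2*h))
      = (real (n choose j) * real (n+1)) * (2 * real h)^Suc j * e^(n - j) / real (j+1)"
      by (simp add: w_def)
    ultimately show ?thesis by simp
  qed
  have "(\<Sum>j\<le>n. w j * (u j)^2) * (real (n+1) * (2*h))
      \<le> (\<Sum>j\<le>n. w j * (1 / real (j+1))) * (real (n+1) * (2*h))"
    by (intro mult_right_mono sum_mono mult_left_mono u2 w0) auto
  also have "\<dots> = (\<Sum>j\<le>n. real (Suc n choose Suc j) * (2 * real h)^Suc j * e^(Suc n - Suc j))"
    unfolding sum_distrib_right wj ..
  also have "\<dots> \<le> (\<Sum>j\<le>Suc n. real (Suc n choose j) * (2 * real h)^j * e^(Suc n - j))"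
    by (subst sum.atMost_Suc_shift) simp
  also have "\<dots> = real (2*h+e)^Suc n"
    using binomial_ring[of "2*real h" "real e" "Suc n"] by simp
  finally have 2: "(\<Sum>j\<le>n. w j * (u j)^2) * (real (n+1) * (2*h)) \<le> real (2*h+e)^Suc n" .
  have "real S ^ 2 * (real (n+1) * (2*h))
      \<le> real (2*h+e)^n * (\<Sum>j\<le>n. w j * (u j)^2) * (real (n+1) * (2*h))"
    by (rule mult_right_mono[OF 1 mult_nonneg_nonneg[OF of_nat_0_le_iff of_nat_0_le_iff]])
  also have "\<dots> \<le> real (2*h+e)^n * real (2*h+e)^Suc n"
    unfolding mult.assoc by (rule mult_left_mono[OF 2[unfolded mult.assoc] zero_le_power[OF of_nat_0_le_iff]])
  also have "\<dots> = real (2*h+e) ^ (2*n+1)"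
    by (simp only: power_add[symmetric] mult_2 add_Suc_right Suc_eq_plus1 add.assoc)
  finally show ?thesis .
qed

text \<open>One of the \<open>n\<close> factors is split to provide the averaging factor
  \<open>gpoly h\<close>; the other \<open>n - 1\<close> factors are handled by the sum
  \<open>S\<close>, and the two pieces together cost at most \<open>3 * S\<close>.\<close>

lemma coeff_gpoly_power_bound:
  assumes "k \<ge> 2" "n \<ge> 1"
  shows "real (coeff (gpoly k ^ n) s) \<le> 4 * real k ^ n / sqrt (real k ^ 2 * real n)"
proof -
  define h e where "h = k div 2" and "e = k mod 2"
  have k: "k = 2*h+e" and h: "h \<ge> 1" and e: "e \<le> 1"
    using assms by (auto simp: h_def e_def)
  obtain m where n: "n = Suc m" using assms by (cases n) auto
  define S where "S = (\<Sum>j\<le>m. (m choose j) * (j choose (j div 2)) * h^j * e^(m-j))"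
  let ?R = "gpoly k ^ m"
  have A: "coeff (gpoly h * ?R) i \<le> S" for i
    unfolding k S_def by (rule coeff_gpoly_mult_gpoly_power[OF h e])
  have B: "coeff ?R i \<le> S" for i
  proof -
    \<comment> \<open>\<open>gpoly h\<close> has constant term 1, so multiplying by it cannot lower
      a coefficient.\<close>
    have "coeff ?R i = coeff (gpoly h) 0 * coeff ?R (i - 0)"
      using h by (simp add: coeff_gpoly)
    also have "\<dots> \<le> coeff (gpoly h * ?R) i"
      unfolding coeff_mult by (rule member_le_sum) auto
    finally show ?thesis using A[of i] by linarith
  qed
  have "gpoly k ^ n = (gpoly h * ?R) * (1 + monom 1 h) + ?R * monom e (2*h)"
    unfolding n power_Suc by (subst (1) k, subst gpoly_split[OF e]) (simp add: algebra_simps)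
  moreover have "coeff ((gpoly h * ?R) * (1 + monom 1 h)) s \<le> S * poly (1 + monom 1 h) 1"
    by (rule coeff_mult_le[OF A])
  moreover have "coeff (?R * monom e (2*h)) s \<le> S * poly (monom e (2*h)) 1"
    by (rule coeff_mult_le[OF B])
  ultimately have "coeff (gpoly k ^ n) s \<le> S * 2 + S * e"
    by (simp add: poly_monom)
  also have "\<dots> \<le> S * 2 + S * 1" using e by (intro add_left_mono mult_left_mono) auto
  finally have le: "coeff (gpoly k ^ n) s \<le> 3 * S" by simp
  have "real S ^ 2 * (real n * (2*h)) \<le> real k ^ (2*m+1)"
    using weighted_central_binomial_sum[OF h, of m e] by (simp add: S_def k n)
  \<comment> \<open>Rounding \<open>k / 2\<close> down is worst at \<open>k = 3\<close>,
    \<open>h = 1\<close>, where equality holds.\<close>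
  moreover have "2 * k \<le> 3 * (2 * h)" using k h e by linarith
  hence "real S ^ 2 * (real n * (2 * real k)) \<le> real S ^ 2 * (real n * (3 * (2*h)))"
    by (intro mult_left_mono) auto
  ultimately have "2 * real k * (real S ^ 2 * real n) \<le> 3 * real k ^ (2*m+1)" by (simp add: mult_ac)
  hence "real k * (2 * (real S ^ 2 * real n)) \<le> real k * (3 * real k ^ (2*m))" by (simp add: mult_ac)
  hence "2 * (real S ^ 2 * real n) \<le> 3 * real k ^ (2*m)"
    using assms by (subst (asm) mult_le_cancel_left_pos) auto
  moreover have "real k ^ (2*m) \<ge> 0" by simp
  \<comment> \<open>The constant 27/2 is rounded up to the square 16, the source of the 4 in the
    bound.\<close>
  ultimately have "9 * (real S ^ 2 * real n) \<le> 16 * real k ^ (2*m)" by linarith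
  hence "real k^2 * (9 * (real S ^ 2 * real n)) \<le> real k^2 * (16 * real k ^ (2*m))"
    by (intro mult_left_mono) auto
  hence "(3 * real S * sqrt (real k^2 * real n))^2 \<le> (4 * real k ^ n)^2"
    by (simp add: n power_mult_distrib power_mult power2_eq_square mult_ac)
  hence "3 * real S * sqrt (real k^2 * real n) \<le> 4 * real k ^ n"
    by (rule power2_le_imp_le) auto
  hence "3 * real S \<le> 4 * real k ^ n / sqrt (real k^2 * real n)"
    using assms by (subst pos_le_divide_eq) auto
  moreover have "real (coeff (gpoly k ^ n) s) \<le> real (3 * S)" using le of_nat_le_iff by blast
  ultimately show ?thesis by simp
qed

section \<open>Symmetric chain decompositions\<close>

definition icube :: "nat \<Rightarrow> 'a set \<Rightarrow> ('a \<Rightarrow> nat) set" where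
  "icube k I = {v. (\<forall>i\<in>I. v i \<in> {1..k}) \<and> (\<forall>i. i \<notin> I \<longrightarrow> v i = 0)}"

lemma icube_empty: "icube k {} = {\<lambda>_. 0}"
  by (auto simp: icube_def)

lemma icube_insert:
  assumes "a \<notin> I"
  shows "v \<in> icube k (insert a I) \<longleftrightarrow> v(a := 0) \<in> icube k I \<and> v a \<in> {1..k}"
  using assms by (auto simp: icube_def)

lemma icube_upd:
  assumes "a \<notin> I" "x \<in> icube k I"
  shows "(x(a := j))(a := 0) = x"
  using assms by (auto simp: icube_def)

lemma icube_eq_iff: "x \<in> icube k I \<Longrightarrow> y \<in> icube k I \<Longrightarrow> x = y \<longleftrightarrow> (\<forall>i\<in>I. x i = y i)"
  by (auto simp: icube_def fun_eq_iff)

lemma finite_card_icube: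
  assumes "finite I"
  shows "finite (icube k I) \<and> card (icube k I) = k ^ card I"
  using assms
proof (induction I)
  case empty
  show ?case by (simp add: icube_empty)
next
  case (insert a I)
  let ?f = "\<lambda>(x, j). x(a := j)"
  have inj: "inj_on ?f (icube k I \<times> {1..k})"
  proof (rule inj_onI, clarify)
    fix x j y l assume "x \<in> icube k I" "y \<in> icube k I" and eq: "x(a := j) = y(a := l)"
    moreover from this have "x = y" using icube_upd[OF insert(2)] by metis
    ultimately show "x = y \<and> j = l" by (metis fun_upd_same)
  qed
  have "icube k (insert a I) = ?f ` (icube k I \<times> {1..k})"
  proof (intro set_eqI iffI)
    fix v assume "v \<in> icube k (insert a I)"
    thus "v \<in> ?f ` (icube k I \<times> {1..k})"
      by (intro image_eqI[of _ _ "(v(a := 0), v a)"]) (auto simp: icube_insert[OF insert(2)])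
  next
    fix v assume "v \<in> ?f ` (icube k I \<times> {1..k})"
    thus "v \<in> icube k (insert a I)"
      using icube_upd[OF insert(2)] by (auto simp: icube_insert[OF insert(2)])
  qed
  thus ?case using insert inj by (simp add: card_image card_cartesian_product)
qed

lemmas finite_icube = finite_card_icube[THEN conjunct1]
  and card_icube = finite_card_icube[THEN conjunct2]

lemma sum_fun_upd_insert:
  assumes "finite I" "a \<notin> I"
  shows "sum v (insert a I) = sum (v(a := 0)) I + (v a :: nat)"
proof -
  have "sum (v(a := 0)) I = sum v I" using assms by (intro sum.cong) auto
  thus ?thesis using assms by simp
qed

text \<open>Entries start at 1, hence the factor \<open>X\<close> before \<open>gpoly k\<close>. The
  layer is sorted by the value of the new coordinate, and deleting that coordinate is injective on
  each class.\<close>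

lemma card_layer_le:
  assumes "finite I"
  shows "card {v \<in> icube k I. sum v I = s} \<le> coeff ((monom 1 1 * gpoly k) ^ card I) s"
  using assms
proof (induction I arbitrary: s)
  case empty
  show ?case by (cases "s = 0") (simp_all add: icube_empty)
next
  case (insert a I)
  let ?L = "\<lambda>s. {v \<in> icube k I. sum v I = s}"
  let ?M = "\<lambda>j. {v \<in> icube k (insert a I). sum v (insert a I) = s \<and> v a = j}"
  let ?p = "(monom 1 1 * gpoly k) ^ card I"
  have M: "card (?M j) \<le> (if j \<le> s then coeff ?p (s - j) else 0)" for j
  proof (cases "j \<le> s")
    case True
    have "card (?M j) \<le> card (?L (s - j))"
    proof (rule card_inj_on_le)
      show "inj_on (\<lambda>v. v(a := 0)) (?M j)"
      proof (rule inj_onI)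
        fix v w assume "v \<in> ?M j" "w \<in> ?M j" "v(a := 0) = w(a := 0)"
        thus "v = w" by (auto simp: fun_eq_iff split: if_splits) metis
      qed
      show "(\<lambda>v. v(a := 0)) ` ?M j \<subseteq> ?L (s - j)"
        using sum_fun_upd_insert[OF insert(1,2)] by (auto simp: icube_insert[OF insert(2)])
      show "finite (?L (s - j))" using finite_icube[OF insert(1)] by simp
    qed
    thus ?thesis using insert.IH[of "s - j"] True by simp
  next
    case False
    hence "?M j = {}" using sum_fun_upd_insert[OF insert(1,2)] by auto
    thus ?thesis by (simp only: card.empty)
  qed
  have "{v \<in> icube k (insert a I). sum v (insert a I) = s} = (\<Union>j\<in>{1..k}. ?M j)"
    by (auto simp: icube_insert[OF insert(2)])
  hence "card {v \<in> icube k (insert a I). sum v (insert a I) = s} \<le> (\<Sum>j\<in>{1..k}. card (?M j))"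
    using card_UN_le[of "{1..k}" ?M] by (simp only: finite_atLeastAtMost)
  also have "\<dots> \<le> (\<Sum>j\<in>{1..k}. if j \<le> s then coeff ?p (s - j) else 0)"
    by (rule sum_mono) (rule M)
  also have "\<dots> = (\<Sum>x<k. if Suc x \<le> s then coeff ?p (s - Suc x) else 0)"
    by (rule sum.reindex_bij_witness[of _ Suc "\<lambda>j. j - 1"]) auto
  also have "\<dots> = coeff ((\<Sum>x<k. monom 1 (Suc x)) * ?p) s"
    unfolding sum_distrib_right coeff_sum coeff_monom_mult by (intro sum.cong) auto
  also have "(\<Sum>x<k. monom 1 (Suc x)) = monom (1::nat) 1 * gpoly k"
    by (simp add: gpoly_def sum_distrib_left mult_monom)
  finally show ?case using insert(1,2) by (simp add: mult.assoc)
qed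

lemma card_layer_bound:
  assumes "finite I" "I \<noteq> {}" "k \<ge> 2"
  shows "real (card {v \<in> icube k I. sum v I = s})
    \<le> 4 * real k ^ card I / sqrt (real k ^ 2 * real (card I))"
proof -
  have n: "card I \<ge> 1" using assms by (simp add: Suc_le_eq card_gt_0_iff)
  \<comment> \<open>The factors \<open>X\<close> shift the index by \<open>card I\<close>, the
    smallest possible rank.\<close>
  have "coeff ((monom 1 1 * gpoly k) ^ card I) s
      = (if card I \<le> s then coeff (gpoly k ^ card I) (s - card I) else 0)"
    by (simp add: power_mult_distrib monom_power coeff_monom_mult del: One_nat_def)
  also have "real \<dots> \<le> 4 * real k ^ card I / sqrt (real k ^ 2 * real (card I))"
    using coeff_gpoly_power_bound[OF assms(3) n] by simp
  finally show ?thesis using card_layer_le[OF assms(1), of k s] by linarith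
qed

text \<open>\<open>card I * (k + 1)\<close> is the smallest plus the largest rank of the cube, so
  the ranks of the chain are symmetric about the middle; filling a whole interval, they include the
  middle rank.\<close>

definition symmetric_chain :: "nat \<Rightarrow> 'a set \<Rightarrow> ('a \<Rightarrow> nat) set \<Rightarrow> bool" where
  "symmetric_chain k I C \<longleftrightarrow> C \<subseteq> icube k I \<and> (\<forall>x\<in>C. \<forall>y\<in>C. x \<le> y \<or> y \<le> x) \<and>
     (\<exists>lo hi. lo \<le> hi \<and> lo + hi = card I * (k + 1) \<and> (\<lambda>v. sum v I) ` C = {lo..hi})"

lemma icube_rank_mono:
  assumes "finite I" "x \<in> icube k I" "y \<in> icube k I" "x \<le> y \<or> y \<le> x" "sum x I \<le> sum y I"
  shows "x \<le> y"
proof (cases "x \<le> y")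
  case False
  hence le: "y \<le> x" using assms by blast
  hence "sum x I = sum y I" using assms(5) sum_mono[of I y x] by (simp add: le_fun_def le_antisym)
  hence "x i = y i" if "i \<in> I" for i
    using sum_mono_inv[of y I x i] le that assms(1) by (simp add: le_fun_def)
  hence "x = y" using icube_eq_iff[OF assms(2,3)] by blast
  thus ?thesis by simp
qed

text \<open>
  The product of a symmetric chain with \<open>{1..k}\<close> is cut into the hooks
  of the de Bruijn--Tengbergen--Kruyswijk construction.
\<close>

definition hook :: "nat \<Rightarrow> 'a set \<Rightarrow> 'a \<Rightarrow> ('a \<Rightarrow> nat) set \<Rightarrow> nat \<Rightarrow> ('a \<Rightarrow> nat) set" where
  "hook k I a C t = {v \<in> icube k (insert a I). v(a := 0) \<in> C \<and>
     min (v a) (Max ((\<lambda>v. sum v I) ` C) + 1 - sum (v(a := 0)) I) = t}"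

text \<open>The hook first climbs \<open>C\<close> with \<open>a\<close>-coordinate \<open>t\<close>
  up to rank \<open>hi + 1 - t\<close> in \<open>C\<close>, then stays there and raises the
  \<open>a\<close>-coordinate to \<open>k\<close>. Its end ranks \<open>lo + t\<close> and
  \<open>hi + 1 - t + k\<close> have a sum independent of \<open>t\<close>.\<close>

lemma symmetric_chain_hook:
  assumes fin: "finite I" and a: "a \<notin> I"
    and C: "symmetric_chain k I C" and ne: "hook k I a C t \<noteq> {}"
  shows "symmetric_chain k (insert a I) (hook k I a C t)"
proof -
  let ?r = "\<lambda>v. sum v I"
  let ?H = "hook k I a C t"
  have sub: "C \<subseteq> icube k I" and chain: "\<And>x y. x \<in> C \<Longrightarrow> y \<in> C \<Longrightarrow> x \<le> y \<or> y \<le> x"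
    using C unfolding symmetric_chain_def by auto
  obtain lo hi where lohi: "lo \<le> hi" "lo + hi = card I * (k + 1)" "?r ` C = {lo..hi}"
    using C unfolding symmetric_chain_def by (elim conjE exE)
  have max_eq: "Max {lo..hi} = hi" using lohi(1) by (intro Max_eqI) auto
  have H: "v \<in> ?H \<longleftrightarrow> v(a := 0) \<in> C \<and> v a \<in> {1..k} \<and> min (v a) (hi + 1 - ?r (v(a := 0))) = t" for v
    using sub unfolding hook_def lohi(3) max_eq by (auto simp: icube_insert[OF a])
  have r: "lo \<le> ?r x \<and> ?r x \<le> hi" if "x \<in> C" for x
    using that lohi(3) by (metis atLeastAtMost_iff imageI)
  have rank: "sum v (insert a I) = ?r (v(a := 0)) + v a" for v :: "'a \<Rightarrow> nat"
    by (rule sum_fun_upd_insert[OF fin a])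
  have mono: "x \<le> y" if "x \<in> C" "y \<in> C" "?r x \<le> ?r y" for x y
    using icube_rank_mono[OF fin _ _ chain] that sub by (meson subsetD)
  have le: "v \<le> w" if "v(a := 0) \<le> w(a := 0)" "v a \<le> w a" for v w :: "'a \<Rightarrow> nat"
    using that by (auto simp: le_fun_def split: if_splits)
  obtain v0 where v0: "v0 \<in> ?H" using ne by blast
  \<comment> \<open>These bounds make the natural subtraction \<open>hi + 1 - t\<close> exact, with
    a value in \<open>{lo..hi}\<close>.\<close>
  have t: "1 \<le> t" "t \<le> k" "t \<le> hi + 1 - lo"
    using v0 r[of "v0(a := 0)"] by (auto simp: H)
  have chain': "v \<le> w \<or> w \<le> v" if v: "v \<in> ?H" and w: "w \<in> ?H" for v w
  proof -
    have "?r (v(a := 0)) \<le> ?r (w(a := 0)) \<and> v a \<le> w a \<or> ?r (w(a := 0)) \<le> ?r (v(a := 0)) \<and> w a \<le> v a"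
      using v w r[of "v(a := 0)"] r[of "w(a := 0)"] unfolding H by (auto simp: min_def split: if_splits)
    thus ?thesis using v w mono le unfolding H by blast
  qed
  have range': "(\<lambda>v. sum v (insert a I)) ` ?H = {lo + t..hi + 1 - t + k}"
  proof (intro set_eqI iffI)
    fix \<rho> assume "\<rho> \<in> (\<lambda>v. sum v (insert a I)) ` ?H"
    then obtain v where "v \<in> ?H" "\<rho> = ?r (v(a := 0)) + v a" unfolding rank by blast
    thus "\<rho> \<in> {lo + t..hi + 1 - t + k}"
      using r[of "v(a := 0)"] unfolding H by auto
  next
    fix \<rho> assume rho: "\<rho> \<in> {lo + t..hi + 1 - t + k}"
    \<comment> \<open>Rank in \<open>C\<close> of the witness: on the first arm of the hook up to
      total rank \<open>hi + 1\<close>, on the second arm beyond it.\<close>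
    define s where "s = (if \<rho> \<le> hi + 1 then \<rho> - t else hi + 1 - t)"
    have "s \<in> {lo..hi}" using rho t by (auto simp: s_def)
    then obtain x where x: "x \<in> C" "?r x = s" using lohi(3) by (metis imageE)
    define v where "v = x(a := \<rho> - s)"
    have v0: "v(a := 0) = x" "v a = \<rho> - s"
      using icube_upd[OF a] x sub by (auto simp: v_def)
    have "v \<in> ?H" unfolding H v0 x(2)
      using rho t x(1) by (auto simp: s_def)
    moreover have "sum v (insert a I) = \<rho>" unfolding rank v0 x(2)
      using rho t by (auto simp: s_def)
    ultimately show "\<rho> \<in> (\<lambda>v. sum v (insert a I)) ` ?H" by blast
  qed
  have le': "lo + t \<le> hi + 1 - t + k" using t lohi(1) by linarith
  have sum': "(lo + t) + (hi + 1 - t + k) = card (insert a I) * (k + 1)"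
    using t lohi(1,2) fin a by simp
  have sub': "?H \<subseteq> icube k (insert a I)" by (auto simp: hook_def)
  show ?thesis unfolding symmetric_chain_def
    by (intro conjI ballI exI[of _ "lo + t"] exI[of _ "hi + 1 - t + k"] chain' range' le' sum' sub')
qed

lemma symmetric_chain_decomposition:
  assumes "finite I" "k \<ge> 1"
  shows "\<exists>\<C>. partition_on (icube k I) \<C> \<and> (\<forall>C\<in>\<C>. symmetric_chain k I C)"
  using assms(1)
proof (induction I)
  case empty
  have "symmetric_chain k {} {\<lambda>_. 0}"
    by (auto simp: symmetric_chain_def icube_empty)
  moreover have "partition_on (icube k {}) {{\<lambda>_. 0}}"
    by (auto simp: partition_on_def icube_empty)
  ultimately show ?case by blast
next
  case (insert a I)
  then obtain \<C> where part: "partition_on (icube k I) \<C>" and sc: "\<And>C. C \<in> \<C> \<Longrightarrow> symmetric_chain k I C"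
    by blast
  \<comment> \<open>\<open>t\<close> runs over all naturals, so empty hooks occur; a partition has
    no empty block.\<close>
  define \<D> where "\<D> = {hook k I a C t | C t. C \<in> \<C>} - {{}}"
  have "partition_on (icube k (insert a I)) \<D>"
  proof (rule partition_onI)
    show "\<Union>\<D> = icube k (insert a I)"
    proof (intro set_eqI iffI)
      fix v assume v: "v \<in> icube k (insert a I)"
      then obtain C where "C \<in> \<C>" "v(a := 0) \<in> C"
        using part unfolding icube_insert[OF insert(2)] partition_on_def by blast
      moreover from this obtain t where "v \<in> hook k I a C t"
        using v by (auto simp: hook_def)
      ultimately show "v \<in> \<Union>\<D>" unfolding \<D>_def by blast
    qed (auto simp: \<D>_def hook_def)
  next
    fix H H' assume H: "H \<in> \<D>" "H' \<in> \<D>" "H \<noteq> H'"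
    then obtain C t C' t' where *: "H = hook k I a C t" "H' = hook k I a C' t'" "C \<in> \<C>" "C' \<in> \<C>"
      unfolding \<D>_def by blast
    show "disjnt H H'"
    proof (rule ccontr)
      assume "\<not> disjnt H H'"
      then obtain v where v: "v \<in> H" "v \<in> H'" by (auto simp: disjnt_def)
      hence "v(a := 0) \<in> C" "v(a := 0) \<in> C'" by (auto simp: * hook_def)
      hence "C = C'" using part *(3,4) by (auto simp: partition_on_def disjoint_def)
      moreover from this v have "t = t'" by (auto simp: * hook_def)
      ultimately show False using H * by simp
    qed
  qed (auto simp: \<D>_def)
  moreover have "symmetric_chain k (insert a I) H" if "H \<in> \<D>" for H
    using that symmetric_chain_hook[OF insert(1,2) sc] unfolding \<D>_def by blast
  ultimately show ?case by blast
qed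

text \<open>Every symmetric chain meets the middle layer, and disjoint chains do so in different
  points; hence there are at most as many chains as points in that layer.\<close>

lemma icube_chain_partition:
  assumes "finite I" "I \<noteq> {}" "k \<ge> 2"
  shows "\<exists>\<C>. partition_on (icube k I) \<C> \<and> (\<forall>C\<in>\<C>. \<forall>x\<in>C. \<forall>y\<in>C. x \<le> y \<or> y \<le> x) \<and>
    real (card \<C>) \<le> 4 * real k ^ card I / sqrt (real k ^ 2 * real (card I))"
proof -
  obtain \<C> where part: "partition_on (icube k I) \<C>" and sc: "\<forall>C\<in>\<C>. symmetric_chain k I C"
    using symmetric_chain_decomposition[of I k] assms by auto
  let ?L = "{v \<in> icube k I. sum v I = card I * (k + 1) div 2}"
  have "\<exists>v\<in>C. sum v I = card I * (k + 1) div 2" if C: "C \<in> \<C>" for C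
  proof -
    obtain lo hi where "lo \<le> hi" "lo + hi = card I * (k + 1)" "(\<lambda>v. sum v I) ` C = {lo..hi}"
      using sc[rule_format, OF C] unfolding symmetric_chain_def by (elim conjE exE)
    moreover from this have "card I * (k + 1) div 2 \<in> {lo..hi}" by auto
    ultimately show ?thesis by (metis (no_types, lifting) imageE)
  qed
  then obtain f where f: "\<And>C. C \<in> \<C> \<Longrightarrow> f C \<in> C \<and> sum (f C) I = card I * (k + 1) div 2"
    by metis
  have "card \<C> \<le> card ?L"
  proof (rule card_inj_on_le)
    show "inj_on f \<C>"
    proof (rule inj_onI)
      fix C D assume "C \<in> \<C>" "D \<in> \<C>" "f C = f D"
      moreover from this have "f C \<in> C \<inter> D" using f[of C] f[of D] by simp
      ultimately show "C = D" using part by (auto simp: partition_on_def disjoint_def)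
    qed
    show "f ` \<C> \<subseteq> ?L" using f part by (auto simp: partition_on_def)
    show "finite ?L" using finite_icube[OF assms(1)] by simp
  qed
  hence "real (card \<C>) \<le> real (card ?L)" by simp
  also have "\<dots> \<le> 4 * real k ^ card I / sqrt (real k ^ 2 * real (card I))"
    by (rule card_layer_bound[OF assms])
  finally show ?thesis using part sc unfolding symmetric_chain_def by (intro exI[of _ \<C>]) simp
qed

section \<open>Pair counting along chains\<close>

text \<open>
  No ambient cube is mentioned: if \<open>F\<close> lies in \<open>[k]\<^sup>I\<close>, then \<open>v0 \<in> F\<close> and \<open>v0 + vs i \<in> F\<close> already
  force \<open>vs i\<close> to be supported on \<open>I\<close> with entries below \<open>k\<close>.
\<close>

definition has_alg :: "nat \<Rightarrow> (nat \<Rightarrow> nat) set \<Rightarrow> bool" where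
  "has_alg d F \<longleftrightarrow> (\<exists>v0 vs. (\<forall>i\<in>{1..d}. vs i \<noteq> (\<lambda>_. 0)) \<and>
     (\<forall>i\<in>{1..d}. \<forall>j\<in>{1..d}. i \<noteq> j \<longrightarrow> disjoint_vec (vs i) (vs j)) \<and>
     (\<forall>S\<subseteq>{1..d}. (\<lambda>x. v0 x + (\<Sum>i\<in>S. vs i x)) \<in> F))"

lemma has_alg_0: "has_alg 0 F \<longleftrightarrow> F \<noteq> {}"
proof
  assume "F \<noteq> {}"
  then obtain v where "v \<in> F" by blast
  thus "has_alg 0 F" unfolding has_alg_def by (intro exI[of _ v]) simp
qed (auto simp: has_alg_def)

text \<open>The difference \<open>c' - c\<close> is nonzero and supported on \<open>I\<close>, the
  given directions on \<open>J\<close>, so it serves as direction \<open>Suc d\<close>. Over the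
  base point \<open>c + v0\<close>, choosing it replaces \<open>c\<close> by
  \<open>c'\<close>.\<close>

lemma has_alg_Suc:
  assumes "I \<inter> J = {}" and c: "c \<in> icube k I" "c' \<in> icube k I" "c \<le> c'" "c \<noteq> c'"
    and alg: "has_alg d {x \<in> icube k J. (\<lambda>i. c i + x i) \<in> F \<and> (\<lambda>i. c' i + x i) \<in> F}"
  shows "has_alg (Suc d) F"
proof -
  obtain v0 vs where nz: "\<forall>i\<in>{1..d}. vs i \<noteq> (\<lambda>_. 0)"
    and dj: "\<forall>i\<in>{1..d}. \<forall>j\<in>{1..d}. i \<noteq> j \<longrightarrow> disjoint_vec (vs i) (vs j)"
    and S: "\<forall>S\<subseteq>{1..d}. (\<lambda>x. v0 x + (\<Sum>i\<in>S. vs i x)) \<in>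
      {x \<in> icube k J. (\<lambda>i. c i + x i) \<in> F \<and> (\<lambda>i. c' i + x i) \<in> F}"
    using alg unfolding has_alg_def by (elim exE conjE)
  define u where "u i = c' i - c i" for i
  define ws where "ws i = (if i = Suc d then u else vs i)" for i
  have cu: "c i + u i = c' i" for i using c(3) by (simp add: u_def le_fun_def)
  have u: "u \<noteq> (\<lambda>_. 0)"
  proof
    assume "u = (\<lambda>_. 0)"
    hence "c = c'" using cu by (metis add_0_right ext)
    thus False using c(4) by simp
  qed
  have uJ: "u z = 0" if "z \<in> J" for z
    using that c assms(1) by (auto simp: u_def icube_def)
  \<comment> \<open>The singleton sum lies in \<open>icube k J\<close>, so each summand vanishes off
    \<open>J\<close>.\<close>
  have vJ: "vs i z = 0" if "i \<in> {1..d}" "z \<notin> J" for i z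
  proof -
    have "(\<lambda>x. v0 x + (\<Sum>i\<in>{i}. vs i x)) \<in> icube k J" using S[rule_format, of "{i}"] that by simp
    thus ?thesis using that by (auto simp: icube_def)
  qed
  have du: "disjoint_vec u (vs i) \<and> disjoint_vec (vs i) u" if "i \<in> {1..d}" for i
    using uJ vJ[OF that] unfolding disjoint_vec_def by metis
  have split: "{1..Suc d} = insert (Suc d) {1..d}" by auto
  show ?thesis unfolding has_alg_def
  proof (intro exI[of _ "\<lambda>x. c x + v0 x"] exI[of _ ws] conjI ballI allI impI)
    fix i assume "i \<in> {1..Suc d}"
    thus "ws i \<noteq> (\<lambda>_. 0)" using nz u by (auto simp: ws_def)
  next
    fix i j assume "i \<in> {1..Suc d}" "j \<in> {1..Suc d}" "i \<noteq> j"
    thus "disjoint_vec (ws i) (ws j)" using dj du by (auto simp: ws_def)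
  next
    fix T assume T: "T \<subseteq> {1..Suc d}"
    define T' where "T' = T - {Suc d}"
    have T': "T' \<subseteq> {1..d}" using T by (auto simp: T'_def)
    have eq: "(\<Sum>i\<in>T'. ws i x) = (\<Sum>i\<in>T'. vs i x)" for x
      by (rule sum.cong) (auto simp: ws_def T'_def)
    show "(\<lambda>x. c x + v0 x + (\<Sum>i\<in>T. ws i x)) \<in> F"
    proof (cases "Suc d \<in> T")
      case True
      have "(\<Sum>i\<in>T. ws i x) = u x + (\<Sum>i\<in>T'. vs i x)" for x
        using sum.remove[OF finite_subset[OF T] True, of "\<lambda>i. ws i x"]
        by (simp add: eq[symmetric] T'_def ws_def)
      hence "(\<lambda>x. c x + v0 x + (\<Sum>i\<in>T. ws i x)) = (\<lambda>x. c' x + (v0 x + (\<Sum>i\<in>T'. vs i x)))"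
        by (simp add: cu[symmetric] algebra_simps)
      thus ?thesis using S[rule_format, OF T'] by simp
    next
      case False
      hence "T = T'" by (auto simp: T'_def)
      hence "(\<lambda>x. c x + v0 x + (\<Sum>i\<in>T. ws i x)) = (\<lambda>x. c x + (v0 x + (\<Sum>i\<in>T'. vs i x)))"
        by (simp add: eq algebra_simps)
      thus ?thesis using S[rule_format, OF T'] by simp
    qed
  qed
qed

text \<open>Cauchy-Schwarz over \<open>x\<close> bounds the square of the sum \<open>A\<close> by
  \<open>card X\<close> times all pair correlations; the diagonal ones add up to \<open>A\<close>.
  This gives \<open>A * (A - card X) \<le> card C^2 * B * card X\<close>, and for
  \<open>A > card X\<close> the left side is at least \<open>(A - card X)^2\<close>.\<close>

lemma sum_le_of_pair_correlation:
  fixes f :: "'a \<Rightarrow> 'b \<Rightarrow> real" and B :: real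
  assumes fin: "finite C" and 01: "\<And>c x. f c x \<in> {0, 1}" and "B \<ge> 0"
    and pair: "\<And>c c'. c \<in> C \<Longrightarrow> c' \<in> C \<Longrightarrow> c \<noteq> c' \<Longrightarrow> (\<Sum>x\<in>X. f c x * f c' x) \<le> B"
  shows "(\<Sum>c\<in>C. \<Sum>x\<in>X. f c x) \<le> card X + card C * sqrt (B * card X)"
proof -
  define A where "A = (\<Sum>c\<in>C. \<Sum>x\<in>X. f c x)"
  have sq: "f c x * f c x = f c x" and nn: "f c x \<ge> 0" for c x using 01[of c x] by auto
  have A0: "A \<ge> 0" unfolding A_def by (intro sum_nonneg nn)
  have "A = (\<Sum>x\<in>X. \<Sum>c\<in>C. f c x)" unfolding A_def by (rule sum.swap)
  hence "A^2 \<le> (\<Sum>x\<in>X. (\<Sum>c\<in>C. f c x)^2) * card X"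
    using sum_squared_le_sum_of_squares[of "\<lambda>x. \<Sum>c\<in>C. f c x" X] by (simp add: mult.commute)
  also have "(\<Sum>x\<in>X. (\<Sum>c\<in>C. f c x)^2) = (\<Sum>c\<in>C. \<Sum>c'\<in>C. \<Sum>x\<in>X. f c x * f c' x)"
    unfolding power2_eq_square sum_product
    by (subst sum.swap, intro sum.cong refl, rule sum.swap)
  \<comment> \<open>Diagonal terms use \<open>f^2 = f\<close>; they receive \<open>B\<close> as
    well, which makes the off-diagonal total simply \<open>card C^2 * B\<close>.\<close>
  also have "\<dots> \<le> (\<Sum>c\<in>C. \<Sum>c'\<in>C. (if c' = c then \<Sum>x\<in>X. f c x else 0) + B)"
    using pair \<open>B \<ge> 0\<close> by (intro sum_mono) (auto simp: sq)
  also have "\<dots> = A + card C * (card C * B)"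
    using fin by (simp add: sum.distrib A_def)
  finally have "A^2 \<le> (A + card C * (card C * B)) * card X"
    by (simp add: mult_right_mono)
  hence main: "A * (A - card X) \<le> card C^2 * (B * card X)"
    by (simp add: power2_eq_square algebra_simps)
  show ?thesis
  proof (cases "A \<le> card X")
    case True
    have "0 \<le> card C * sqrt (B * card X)" using \<open>B \<ge> 0\<close> by simp
    thus ?thesis using True unfolding A_def by linarith
  next
    case False
    have "(A - card X)^2 \<le> A * (A - card X)"
      unfolding power2_eq_square using False by (intro mult_right_mono) auto
    also note main
    finally have "A - card X \<le> sqrt (card C^2 * (B * card X))" by (rule real_le_rsqrt)
    also have "\<dots> = card C * sqrt (B * card X)" by (simp add: real_sqrt_mult)
    finally show ?thesis unfolding A_def by linarith
  qed
qed

text \<open>The correlation bound is applied to each chain separately. Its first term is paid once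
  per chain, giving the number of chains; its second is proportional to the chain's size, and the
  sizes add up to \<open>k ^ card I\<close>.\<close>

lemma card_step:
  assumes fin: "finite I" "finite J" and ne: "I \<noteq> {}" and dj: "I \<inter> J = {}" and k: "k \<ge> 2"
    and "\<beta> \<ge> 0"
    and beta: "\<And>G. G \<subseteq> icube k J \<Longrightarrow> \<not> has_alg d G \<Longrightarrow> real (card G) \<le> \<beta> * real k ^ card J"
    and F: "F \<subseteq> icube k (I \<union> J)" "\<not> has_alg (Suc d) F"
  shows "real (card F) \<le> real k ^ (card I + card J) * (4 / sqrt (real k ^ 2 * real (card I)) + sqrt \<beta>)"
proof -
  obtain \<C> where part: "partition_on (icube k I) \<C>"
    and chain: "\<forall>C\<in>\<C>. \<forall>x\<in>C. \<forall>y\<in>C. x \<le> y \<or> y \<le> x"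
    and card: "real (card \<C>) \<le> 4 * real k ^ card I / sqrt (real k ^ 2 * real (card I))"
    using icube_chain_partition[OF fin(1) ne k] by (elim exE conjE)
  have fI: "finite (icube k I)" and fJ: "finite (icube k J)"
    using finite_icube fin by auto
  have sub: "C \<subseteq> icube k I" if "C \<in> \<C>" for C using part that by (auto simp: partition_on_def)
  have fC: "finite C" if "C \<in> \<C>" for C using sub[OF that] fI finite_subset by blast
  have f\<C>: "finite \<C>" using finite_elements[OF fI part] .
  let ?N = "real k ^ card J"
  have N: "real (card (icube k J)) = ?N" using card_icube[OF fin(2)] by simp
  define P where "P C = {p \<in> C \<times> icube k J. (\<lambda>i. fst p i + snd p i) \<in> F}" for C
  have cP: "real (card (P C)) \<le> ?N + card C * (?N * sqrt \<beta>)" if C: "C \<in> \<C>" for C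
  proof -
    define f where "f c x = (if (\<lambda>i. c i + x i) \<in> F then 1 else 0 :: real)" for c x
    have "real (card (P C)) = (\<Sum>p\<in>C \<times> icube k J. f (fst p) (snd p))"
      unfolding P_def f_def using fC[OF C] fJ by (simp add: sum.If_cases Int_def)
    also have "\<dots> = (\<Sum>c\<in>C. \<Sum>x\<in>icube k J. f c x)"
      by (simp add: sum.cartesian_product case_prod_beta)
    also have "\<dots> \<le> card (icube k J) + card C * sqrt ((\<beta> * ?N) * card (icube k J))"
    proof (rule sum_le_of_pair_correlation)
      fix c c' assume c: "c \<in> C" "c' \<in> C" "c \<noteq> c'"
      let ?G = "{x \<in> icube k J. (\<lambda>i. c i + x i) \<in> F \<and> (\<lambda>i. c' i + x i) \<in> F}"
      \<comment> \<open>The same set with \<open>c\<close> and \<open>c'\<close> exchanged, in the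
        form that \<open>has_alg_Suc\<close> takes when \<open>c' \<le> c\<close>.\<close>
      let ?G' = "{x \<in> icube k J. (\<lambda>i. c' i + x i) \<in> F \<and> (\<lambda>i. c i + x i) \<in> F}"
      have "?G' = ?G" by auto
      have "\<not> has_alg d ?G"
      proof
        assume alg: "has_alg d ?G"
        hence alg': "has_alg d ?G'" unfolding \<open>?G' = ?G\<close> .
        have "c \<le> c' \<or> c' \<le> c" using chain C c by blast
        thus False
        proof
          assume "c \<le> c'"
          thus False using has_alg_Suc[OF dj _ _ _ c(3) alg] sub[OF C] c F(2) by blast
        next
          assume "c' \<le> c"
          thus False using has_alg_Suc[OF dj _ _ _ c(3)[symmetric] alg'] sub[OF C] c F(2) by blast
        qed
      qed
      hence "real (card ?G) \<le> \<beta> * ?N" by (intro beta) auto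
      moreover have "(\<Sum>x\<in>icube k J. f c x * f c' x) = (\<Sum>x\<in>icube k J. if x \<in> ?G then 1 else 0)"
        by (rule sum.cong) (auto simp: f_def)
      moreover have "\<dots> = real (card ?G)" using fJ by (simp add: sum.If_cases Int_def)
      ultimately show "(\<Sum>x\<in>icube k J. f c x * f c' x) \<le> \<beta> * ?N" by linarith
    qed (use fC[OF C] \<open>\<beta> \<ge> 0\<close> in \<open>auto simp: f_def\<close>)
    also have "sqrt ((\<beta> * ?N) * card (icube k J)) = ?N * sqrt \<beta>"
      unfolding N by (simp add: real_sqrt_mult mult_ac)
    finally show ?thesis unfolding N .
  qed
  have "F \<subseteq> (\<Union>C\<in>\<C>. (\<lambda>p i. fst p i + snd p i) ` P C)"
  proof
    fix v assume v: "v \<in> F"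
    define c where "c i = (if i \<in> I then v i else 0)" for i
    define x where "x i = (if i \<in> J then v i else 0)" for i
    have cube: "v \<in> icube k (I \<union> J)" using v F(1) by blast
    \<comment> \<open>Each part is 0 off its own index set, so adding them glues the point
      together.\<close>
    have eq: "(\<lambda>i. c i + x i) = v" using cube dj by (auto simp: c_def x_def icube_def fun_eq_iff)
    have "c \<in> icube k I" "x \<in> icube k J" using cube by (auto simp: c_def x_def icube_def)
    moreover from this obtain C where "C \<in> \<C>" "c \<in> C" using part unfolding partition_on_def by blast
    ultimately have "(c, x) \<in> P C" using v eq by (simp add: P_def)
    hence "v \<in> (\<lambda>p i. fst p i + snd p i) ` P C" using eq by (intro image_eqI[of _ _ "(c, x)"]) auto
    thus "v \<in> (\<Union>C\<in>\<C>. (\<lambda>p i. fst p i + snd p i) ` P C)" using \<open>C \<in> \<C>\<close> by blast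
  qed
  moreover have fP: "finite (P C)" if "C \<in> \<C>" for C using fC[OF that] fJ by (simp add: P_def)
  ultimately have "card F \<le> card (\<Union>C\<in>\<C>. (\<lambda>p i. fst p i + snd p i) ` P C)"
    using f\<C> by (intro card_mono) auto
  also have "\<dots> \<le> (\<Sum>C\<in>\<C>. card ((\<lambda>p i. fst p i + snd p i) ` P C))"
    by (rule card_UN_le[OF f\<C>])
  also have "\<dots> \<le> (\<Sum>C\<in>\<C>. card (P C))"
    by (intro sum_mono card_image_le fP)
  finally have cF: "real (card F) \<le> (\<Sum>C\<in>\<C>. real (card (P C)))"
    by (metis of_nat_le_iff of_nat_sum)
  have "(\<Sum>C\<in>\<C>. card C) = card (\<Union>\<C>)"
    using part fC by (intro card_Union_disjoint[symmetric])
      (auto simp: partition_on_def disjoint_def pairwise_def disjnt_def)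
  also have "\<Union>\<C> = icube k I" using part by (simp add: partition_on_def)
  finally have sum_card: "real (\<Sum>C\<in>\<C>. card C) = real k ^ card I"
    using card_icube[OF fin(1)] by simp
  note cF
  also have "(\<Sum>C\<in>\<C>. real (card (P C))) \<le> (\<Sum>C\<in>\<C>. ?N + card C * (?N * sqrt \<beta>))"
    by (intro sum_mono cP)
  also have "\<dots> = card \<C> * ?N + real (\<Sum>C\<in>\<C>. card C) * (?N * sqrt \<beta>)"
    by (simp add: sum.distrib sum_distrib_right)
  also have "\<dots> \<le> (4 * real k ^ card I / sqrt (real k ^ 2 * real (card I))) * ?N
      + real k ^ card I * (?N * sqrt \<beta>)"
    unfolding sum_card by (intro add_right_mono mult_right_mono card) auto
  also have "\<dots> = real k ^ (card I + card J) * (4 / sqrt (real k ^ 2 * real (card I)) + sqrt \<beta>)"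
    by (simp add: power_add algebra_simps)
  finally show ?thesis .
qed

text \<open>This is why the constant 16 does not grow with \<open>d\<close>: its root is 4, halving
  the argument costs at most \<open>2 powr e \<le> 2\<close>, giving 8, and the chain term gives
  another \<open>4 * 2 = 8\<close>.\<close>

lemma card_bound_numeric:
  fixes M e m1 m2 :: real
  assumes "M > 0" "0 \<le> e" "e \<le> 1" "1 / sqrt m1 \<le> 2 * M powr (-e)" "m2 \<ge> M / 2"
  shows "4 / sqrt m1 + sqrt (16 * m2 powr (-(2*e))) \<le> 16 * M powr (-e)"
proof -
  have m2: "m2 > 0" using assms by linarith
  have "m2 powr (-(2*e)) = (m2 powr (-e))^2"
    by (simp add: power2_eq_square flip: powr_add)
  hence "sqrt (16 * m2 powr (-(2*e))) = 4 * m2 powr (-e)"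
    by (simp add: real_sqrt_mult)
  also have "m2 powr (-e) \<le> (M / 2) powr (-e)"
    using assms by (intro powr_mono2') auto
  also have "(M / 2) powr (-e) = 2 powr e * M powr (-e)"
    using assms by (simp add: powr_divide powr_minus field_simps)
  also have "2 powr e \<le> 2 powr (1::real)" using assms by (intro powr_mono) auto
  finally have "sqrt (16 * m2 powr (-(2*e))) \<le> 8 * M powr (-e)"
    by (simp add: mult_right_mono)
  thus ?thesis using assms(4) by simp
qed

text \<open>From \<open>2 * d \<le> 2 ^ d\<close>, the power of \<open>M\<close> is at most
  \<open>2 powr (d / 2 ^ d)\<close>, far below 16. In this range the trivial bound
  \<open>k ^ n\<close> suffices.\<close>

lemma card_bound_trivial:
  fixes d :: nat
  assumes "d \<ge> 1" "M \<ge> 1" "M \<le> real (2 * d) ^ 2"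
  shows "1 \<le> 16 * M powr (-(1 / 2 ^ Suc d))"
proof -
  have "2 * d \<le> 2 ^ d" using assms(1)
  proof (induction d rule: nat_induct_at_least)
    case (Suc n) thus ?case using one_le_power[of 2 n] by simp
  qed simp
  hence "real (2 * d) \<le> 2 ^ d" by (metis of_nat_le_iff of_nat_numeral of_nat_power)
  hence "real (2 * d)^2 \<le> (2 ^ d)^2" by (intro power_mono) auto
  hence "M \<le> (2::real) ^ (2 * d)" using assms(3) by (simp add: power_mult[symmetric] mult.commute)
  also have "\<dots> = 2 powr (2 * real d)" by (simp add: powr_realpow[symmetric])
  finally have "M powr (1 / 2 ^ Suc d) \<le> (2 powr (2 * real d)) powr (1 / 2 ^ Suc d)"
    using assms by (intro powr_mono2) auto
  also have "\<dots> = 2 powr (real d / 2 ^ d)" by (simp add: powr_powr)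
  also have "\<dots> \<le> 2 powr (4 :: real)"
  proof (rule powr_mono)
    have "real d \<le> 4 * 2 ^ d" using of_nat_less_two_power[of d, where 'a = real] by linarith
    thus "real d / 2 ^ d \<le> 4" by (simp add: divide_le_eq)
  qed simp
  finally have "M powr (1 / 2 ^ Suc d) \<le> 16" by simp
  moreover have "M powr (1 / 2 ^ Suc d) > 0" using assms by simp
  ultimately show ?thesis by (simp add: powr_minus field_simps)
qed

lemma powr_neg_half: "x \<ge> 0 \<Longrightarrow> x powr (-(1 / 2)) = 1 / sqrt x" for x :: real
  by (simp add: powr_minus_divide powr_half_sqrt)

lemma card_bound:
  assumes "d \<ge> 1" "finite I" "card I \<ge> d" "k \<ge> 2" "F \<subseteq> icube k I" "\<not> has_alg d F"
  shows "real (card F) \<le> 16 * real k ^ card I * (real k ^ 2 * real (card I)) powr (-(1 / 2 ^ d))"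
  using assms
proof (induction d arbitrary: I F rule: nat_induct_at_least)
  case base
  have "I \<noteq> {}" using base by auto
  \<comment> \<open>All coordinates go into \<open>I\<close>; a family without a 0-dimensional
    algebra is empty, so the density on \<open>J = {}\<close> is 0.\<close>
  have "real (card F) \<le> real k ^ (card I + card ({} :: nat set)) * (4 / sqrt (real k ^ 2 * real (card I)) + sqrt 0)"
  proof (rule card_step[where d = 0])
    show "\<not> has_alg (Suc 0) F" using base by simp
    show "F \<subseteq> icube k (I \<union> {})" using base by simp
    show "real (card G) \<le> 0 * real k ^ card {}" if "\<not> has_alg 0 G" for G
      using that by (simp add: has_alg_0)
  qed (use base \<open>I \<noteq> {}\<close> in simp_all)
  also have "\<dots> = 4 * real k ^ card I * (real k ^ 2 * real (card I)) powr (-(1 / 2 ^ 1))"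
    unfolding power_one_right by (subst powr_neg_half) simp_all
  also have "\<dots> \<le> 16 * real k ^ card I * (real k ^ 2 * real (card I)) powr (-(1 / 2 ^ 1))"
    by (intro mult_right_mono) auto
  finally show ?case .
next
  case (Suc d)
  define n where "n = card I"
  define M where "M = real k ^ 2 * real n"
  define e where "e = (1 / 2 ^ Suc d :: real)"
  have n2: "n \<ge> 2" and nd: "n \<ge> Suc d" using Suc by (auto simp: n_def)
  have "1 * 1 \<le> M" unfolding M_def using n2 \<open>k \<ge> 2\<close> by (intro mult_mono) auto
  hence M1: "M \<ge> 1" by simp
  have "2 ^ 2 \<le> (2::real) ^ Suc d" using Suc.hyps by (intro power_increasing) auto
  hence e: "0 \<le> e" "e \<le> 1 / 4" by (auto simp: e_def field_simps)
  \<comment> \<open>Splitting off \<open>n1\<close> coordinates: \<open>n1 + d \<le> n\<close>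
    permits the induction hypothesis on the rest, \<open>2 * n1 \<le> n\<close> keeps half of
    \<open>M\<close> there, and \<open>le\<close> controls the chain term.\<close>
  have split: ?case if n12: "n1 \<ge> 1" "n1 + d \<le> n" "2 * n1 \<le> n"
    and le: "1 / sqrt (real k ^ 2 * real n1) \<le> 2 * M powr (-e)" for n1
  proof -
    obtain I1 where I1: "I1 \<subseteq> I" "card I1 = n1"
      using obtain_subset_with_card_n[of n1 I] n12 n_def by auto
    define I2 where "I2 = I - I1"
    have fin: "finite I1" "finite I2" using I1 Suc.prems(1) finite_subset by (auto simp: I2_def)
    have I2: "card I2 = n - n1"
      unfolding I2_def using card_Diff_subset[OF fin(1) I1(1)] I1(2) n_def by simp
    define m2 where "m2 = real k ^ 2 * real (card I2)"
    have "real k ^ 2 * real n \<le> real k ^ 2 * (2 * real (n - n1))"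
      using n12 by (intro mult_left_mono) auto
    hence m2: "m2 \<ge> M / 2" by (simp add: m2_def M_def I2)
    have "real (card F) \<le> real k ^ (card I1 + card I2) *
        (4 / sqrt (real k ^ 2 * real (card I1)) + sqrt (16 * m2 powr (-(1 / 2 ^ d))))"
    proof (rule card_step[where d = d])
      fix G assume "G \<subseteq> icube k I2" "\<not> has_alg d G"
      moreover have "card I2 \<ge> d" using I2 n12 by simp
      ultimately have "real (card G) \<le> 16 * real k ^ card I2 * (real k ^ 2 * real (card I2)) powr (-(1 / 2 ^ d))"
        by (intro Suc.IH fin Suc.prems)
      thus "real (card G) \<le> 16 * m2 powr (-(1 / 2 ^ d)) * real k ^ card I2"
        by (simp add: m2_def mult_ac)
    next
      show "F \<subseteq> icube k (I1 \<union> I2)" using Suc.prems I1 by (auto simp: I2_def Un_absorb1)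
      show "I1 \<noteq> {}" using I1 n12 by auto
    qed (use fin Suc.prems in \<open>auto simp: I2_def\<close>)
    also have "\<dots> = real k ^ n * (4 / sqrt (real k ^ 2 * real n1) + sqrt (16 * m2 powr (-(2 * e))))"
      using I1 I2 n12 by (simp add: e_def)
    also have "\<dots> \<le> real k ^ n * (16 * M powr (-e))"
      using le e M1 m2 by (intro mult_left_mono card_bound_numeric) auto
    finally have "real (card F) \<le> real k ^ n * (16 * M powr (-e))" .
    thus ?thesis by (simp add: M_def n_def e_def mult_ac)
  qed
  have Me: "M powr (-(1 / 2)) \<le> M powr (-e)" "M powr (-(1 / 4)) \<le> M powr (-e)"
    using e M1 by (auto intro!: powr_mono)
  \<comment> \<open>Splitting in half must leave \<open>d\<close> coordinates. If it does not, a single coordinate is split off,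
    which is enough for \<open>n \<le> k\<^sup>2\<close>; otherwise the claimed bound exceeds \<open>k\<^sup>n\<close>.\<close>
  consider "2 * d \<le> n" | "n < 2 * d" "n \<le> k^2" | "n < 2 * d" "k^2 < n" by linarith
  thus ?case
  proof cases
    case 1
    have "M / 4 \<le> real k ^ 2 * real (n div 2)"
    proof -
      \<comment> \<open>Rounding leaves at least a quarter of \<open>n\<close>; the root of this
        loss is the factor 2 allowed in \<open>split\<close>.\<close>
      have "n \<le> 4 * (n div 2)" using n2 by linarith
      hence "real n \<le> 4 * real (n div 2)" by linarith
      hence "real k ^ 2 * real n \<le> real k ^ 2 * (4 * real (n div 2))" by (intro mult_left_mono) auto
      thus ?thesis by (simp add: M_def)
    qed
    hence "sqrt (M / 4) \<le> sqrt (real k ^ 2 * real (n div 2))" by simp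
    hence "1 / sqrt (real k ^ 2 * real (n div 2)) \<le> 1 / sqrt (M / 4)"
      using M1 by (intro divide_left_mono) auto
    also have "\<dots> = 2 * M powr (-(1 / 2))"
      using M1 by (simp add: powr_neg_half real_sqrt_divide)
    also note Me(1)
    finally show ?thesis using 1 n2 by (intro split[of "n div 2"]) auto
  next
    case 2
    \<comment> \<open>A single coordinate contributes \<open>1 / k\<close>, comparable to
      \<open>M powr (-(1/4))\<close> as \<open>M \<le> k^4\<close>; the exponent suffices because
      \<open>e \<le> 1/4\<close>.\<close>
    have "M \<le> real k ^ 2 * real k ^ 2"
      unfolding M_def using 2(2) by (intro mult_left_mono) (auto simp flip: of_nat_power)
    also have "\<dots> = real k ^ 4" by (simp flip: power_add)
    also have "\<dots> = real k powr 4" using \<open>k \<ge> 2\<close> by (simp add: powr_numeral)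
    finally have Mk: "M \<le> real k powr 4" .
    have "1 / real k = (real k powr 4) powr (-(1 / 4))"
      using \<open>k \<ge> 2\<close> by (subst powr_powr) (simp add: powr_minus_divide)
    also have "\<dots> \<le> M powr (-(1 / 4))"
      using M1 Mk by (intro powr_mono2') auto
    also note Me(2)
    also have "M powr (-e) \<le> 2 * M powr (-e)" by simp
    finally show ?thesis using n2 nd by (intro split[of 1]) auto
  next
    case 3
    have "M \<le> real n * real n"
      unfolding M_def using 3(2) by (intro mult_right_mono) (auto simp flip: of_nat_power)
    also have "\<dots> \<le> real (2 * d) * real (2 * d)" using 3(1) by (intro mult_mono) auto
    finally have "1 \<le> 16 * M powr (-e)"
      unfolding e_def using Suc.hyps M1 by (intro card_bound_trivial) (auto simp: power2_eq_square)
    hence "real k ^ n * 1 \<le> real k ^ n * (16 * M powr (-e))" by (intro mult_left_mono) auto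
    moreover have "card F \<le> k ^ n"
      using card_mono[OF finite_icube Suc.prems(4)] card_icube Suc.prems(1) unfolding n_def by metis
    hence "real (card F) \<le> real k ^ n" by (metis of_nat_le_iff of_nat_power)
    ultimately have "real (card F) \<le> real k ^ n * (16 * M powr (-e))" by linarith
    thus ?thesis by (simp add: M_def n_def e_def mult_ac)
  qed
qed

section \<open>Transfer to the two formulations\<close>

lemma icube_lessThan: "icube k {..<n} = cube k n"
  by (auto simp: icube_def cube_def)

lemma bool_alg_of_has_alg:
  assumes F: "F \<subseteq> cube k n" and alg: "has_alg d F"
  shows "\<exists>B\<subseteq>F. bool_alg k n d B"
proof -
  obtain v0 vs where nz: "\<forall>i\<in>{1..d}. vs i \<noteq> (\<lambda>_. 0)"
    and dj: "\<forall>i\<in>{1..d}. \<forall>j\<in>{1..d}. i \<noteq> j \<longrightarrow> disjoint_vec (vs i) (vs j)"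
    and S: "\<forall>S\<subseteq>{1..d}. (\<lambda>x. v0 x + (\<Sum>i\<in>S. vs i x)) \<in> F"
    using alg unfolding has_alg_def by (elim exE conjE)
  have v0: "v0 \<in> cube k n" using S[rule_format, of "{}"] F by auto
  have dirs: "vs i \<in> dirs k n" if i: "i \<in> {1..d}" for i
  proof -
    have "(\<lambda>x. v0 x + vs i x) \<in> cube k n" using S[rule_format, of "{i}"] F i by auto
    hence v1: "\<forall>x<n. v0 x + vs i x \<le> k" "\<forall>x\<ge>n. v0 x + vs i x = 0"
      by (auto simp: cube_def)
    \<comment> \<open>Cube entries start at 1, which makes the bound on directions strict.\<close>
    have "\<forall>x<n. 1 \<le> v0 x" using v0 by (auto simp: cube_def)
    hence "\<forall>x<n. vs i x < k" using v1(1) by (metis Suc_le_eq add_le_mono1 order_trans plus_1_eq_Suc)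
    thus ?thesis using v1(2) by (simp add: dirs_def)
  qed
  define B where "B = {(\<lambda>x. v0 x + (\<Sum>i\<in>I. vs i x)) | I. I \<subseteq> {1..d}}"
  have "B \<subseteq> F" using S unfolding B_def by auto
  moreover from this have "bool_alg k n d B"
    unfolding bool_alg_def using F v0 dirs nz dj
    by (intro conjI exI[of _ v0] exI[of _ vs]) (auto simp: B_def)
  ultimately show ?thesis by blast
qed

definition vec_of_set :: "nat \<Rightarrow> nat set \<Rightarrow> nat \<Rightarrow> nat" where
  "vec_of_set n X i = (if i < n then if i \<in> X then 2 else 1 else 0)"

text \<open>With only the values 1 and 2 available, a nonzero direction entry must lift a 1 to a 2.
  So the support of a direction avoids \<open>X 0\<close>, the places where \<open>v0\<close> is 2,
  and adding directions means uniting supports.\<close>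

lemma set_bool_alg_of_has_alg:
  assumes F: "F \<subseteq> Pow {0..<n}" and alg: "has_alg d (vec_of_set n ` F)"
  shows "\<exists>B\<subseteq>F. set_bool_alg n d B"
proof -
  obtain v0 vs where nz: "\<forall>i\<in>{1..d}. vs i \<noteq> (\<lambda>_. 0)"
    and dj: "\<forall>i\<in>{1..d}. \<forall>j\<in>{1..d}. i \<noteq> j \<longrightarrow> disjoint_vec (vs i) (vs j)"
    and S: "\<forall>S\<subseteq>{1..d}. (\<lambda>x. v0 x + (\<Sum>i\<in>S. vs i x)) \<in> vec_of_set n ` F"
    using alg unfolding has_alg_def by (elim exE conjE)
  define X where "X j = (if j = 0 then {i. v0 i = 2} else {i. vs j i \<noteq> 0})" for j :: nat
  have rng: "vec_of_set n Y i \<le> 2" "vec_of_set n Y i \<ge> 1 \<longleftrightarrow> i < n" for Y i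
    by (auto simp: vec_of_set_def)
  have "v0 \<in> vec_of_set n ` F" using S[rule_format, of "{}"] by simp
  then obtain Y0 where v0: "v0 = vec_of_set n Y0" by blast
  have v0n: "v0 i \<ge> 1 \<longleftrightarrow> i < n" and v02: "v0 i \<le> 2" for i
    unfolding v0 by (rule rng)+
  have single: "v0 i + vs j i \<le> 2 \<and> (v0 i + vs j i \<ge> 1 \<longrightarrow> i < n)" if j: "j \<in> {1..d}" for i j
  proof -
    have "(\<lambda>x. v0 x + vs j x) \<in> vec_of_set n ` F" using S[rule_format, of "{j}"] j by simp
    then obtain Y where "(\<lambda>x. v0 x + vs j x) = vec_of_set n Y" by blast
    hence "v0 i + vs j i = vec_of_set n Y i" by metis
    thus ?thesis using rng by simp
  qed
  have Xn: "X j \<subseteq> {0..<n}" if "j \<in> {0..d}" for j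
  proof
    fix i assume i: "i \<in> X j"
    show "i \<in> {0..<n}"
    proof (cases "j = 0")
      case True
      hence "v0 i = 2" using i by (simp add: X_def)
      thus ?thesis using v0n[of i] by simp
    next
      case False
      hence "vs j i \<noteq> 0" using i by (simp add: X_def)
      thus ?thesis using single[of j i] False that by simp
    qed
  qed
  have X0j: "X 0 \<inter> X j = {}" if j: "j \<in> {1..d}" for j
  proof (intro equals0I)
    fix i assume "i \<in> X 0 \<inter> X j"
    hence "v0 i = 2" "vs j i \<noteq> 0" using j by (auto simp: X_def)
    thus False using single[OF j, of i] by simp
  qed
  have Xdj: "X i \<inter> X j = {}" if "i \<in> {1..d}" "j \<in> {1..d}" "i \<noteq> j" for i j
  proof -
    have "disjoint_vec (vs i) (vs j)" using dj that by blast
    hence "\<forall>x. vs i x = 0 \<or> vs j x = 0" by (simp add: disjoint_vec_def)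
    moreover have "X i = {x. vs i x \<noteq> 0}" "X j = {x. vs j x \<noteq> 0}"
      using that by (simp_all add: X_def)
    ultimately show ?thesis by blast
  qed
  have mem: "X 0 \<union> (\<Union>j\<in>T. X j) \<in> F" if T: "T \<subseteq> {1..d}" for T
  proof -
    obtain Y where Y: "Y \<in> F" "(\<lambda>x. v0 x + (\<Sum>i\<in>T. vs i x)) = vec_of_set n Y"
      using S[rule_format, OF T] by blast
    have Yn: "Y \<subseteq> {0..<n}" using Y(1) F by blast
    have X0: "X 0 = {i. v0 i = 2}" and XT: "\<forall>j\<in>T. X j = {i. vs j i \<noteq> 0}"
      using T by (auto simp: X_def)
    have finT: "finite T" using T finite_subset by blast
    have val: "v0 i + (\<Sum>j\<in>T. vs j i) = vec_of_set n Y i" for i using Y(2) by metis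
    have "i \<in> Y \<longleftrightarrow> i \<in> X 0 \<union> (\<Union>j\<in>T. X j)" for i
    proof -
      have "i \<in> Y \<longleftrightarrow> vec_of_set n Y i = 2" using Yn by (auto simp: vec_of_set_def)
      \<comment> \<open>No encoded entry exceeds 2, so being 2 is the same as being at least
        2.\<close>
      also have "\<dots> \<longleftrightarrow> v0 i + (\<Sum>j\<in>T. vs j i) \<ge> 2"
        using rng(1)[of Y i] unfolding val by linarith
      also have "\<dots> \<longleftrightarrow> v0 i = 2 \<or> (\<exists>j\<in>T. vs j i \<noteq> 0)"
      proof
        assume "v0 i + (\<Sum>j\<in>T. vs j i) \<ge> 2"
        moreover note v02[of i]
        ultimately show "v0 i = 2 \<or> (\<exists>j\<in>T. vs j i \<noteq> 0)"
          by (cases "\<exists>j\<in>T. vs j i \<noteq> 0") auto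
      next
        assume "v0 i = 2 \<or> (\<exists>j\<in>T. vs j i \<noteq> 0)"
        thus "v0 i + (\<Sum>j\<in>T. vs j i) \<ge> 2"
        proof
          assume "\<exists>j\<in>T. vs j i \<noteq> 0"
          then obtain j where j: "j \<in> T" "vs j i \<noteq> 0" by blast
          hence "i < n" using single[of j i] T by auto
          hence "v0 i \<ge> 1" using v0n[of i] by simp
          moreover have "vs j i \<le> (\<Sum>j\<in>T. vs j i)" using finT j by (intro member_le_sum) auto
          ultimately show ?thesis using j by linarith
        qed simp
      qed
      also have "\<dots> \<longleftrightarrow> i \<in> X 0 \<union> (\<Union>j\<in>T. X j)" using XT by (simp add: X0)
      finally show ?thesis .
    qed
    hence "Y = X 0 \<union> (\<Union>j\<in>T. X j)" by blast
    thus ?thesis using Y(1) by simp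
  qed
  define B where "B = {X 0 \<union> (\<Union>i\<in>I. X i) | I. I \<subseteq> {1..d}}"
  have "set_bool_alg n d B" unfolding set_bool_alg_def
  proof (intro exI[of _ X] conjI ballI impI)
    fix i j assume ij: "i \<in> {0..d}" "j \<in> {0..d}" "i \<noteq> j"
    consider "i = 0" "j \<in> {1..d}" | "j = 0" "i \<in> {1..d}" | "i \<in> {1..d}" "j \<in> {1..d}"
      using ij by fastforce
    thus "X i \<inter> X j = {}"
    proof cases
      case 1 thus ?thesis using X0j by simp
    next
      case 2 thus ?thesis using X0j[of i] by blast
    next
      case 3 thus ?thesis using Xdj ij(3) by simp
    qed
  next
    fix i assume "i \<in> {1..d}"
    thus "X i \<noteq> {}" using nz by (auto simp: X_def fun_eq_iff)
  qed (simp_all add: Xn B_def)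
  moreover have "B \<subseteq> F" using mem unfolding B_def by blast
  ultimately show ?thesis by blast
qed

text \<open>The factor \<open>k^2\<close> inside the power yields the saving in \<open>k\<close>,
  since \<open>2 / 2 ^ d = 1 / 2 ^ (d - 1)\<close> for \<open>d \<ge> 1\<close>.\<close>

lemma card_bound_cube:
  assumes "k \<ge> 2" "d \<ge> 1" "n \<ge> d" "F \<subseteq> cube k n" "\<not> has_alg d F"
  shows "real (card F) \<le> 16 * real k powr (real n - 1 / 2 ^ (d - 1)) * real n powr (- (1 / 2 ^ d))"
proof -
  have "(real k ^ 2 * real n) powr (-(1 / 2 ^ d)) = (real k ^ 2) powr (-(1 / 2 ^ d)) * real n powr (-(1 / 2 ^ d))"
    by (rule powr_mult)
  also have "(real k ^ 2) powr (-(1 / 2 ^ d)) = real k powr (-(2 / 2 ^ d))"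
    using assms(1) by (simp add: powr_powr flip: powr_numeral)
  also have "2 / 2 ^ d = (1 / 2 ^ (d - 1) :: real)" using assms(2) by (cases d) auto
  finally have "16 * real k ^ n * (real k ^ 2 * real n) powr (-(1 / 2 ^ d))
      = 16 * (real k powr real n * real k powr (-(1 / 2 ^ (d - 1)))) * real n powr (-(1 / 2 ^ d))"
    using assms(1) by (simp add: powr_realpow)
  also have "real k powr real n * real k powr (-(1 / 2 ^ (d - 1))) = real k powr (real n - 1 / 2 ^ (d - 1))"
    by (simp flip: powr_add)
  finally show ?thesis
    using card_bound[of d "{..<n}" k F] assms by (simp add: icube_lessThan)
qed

lemma b_bound:
  assumes "d \<ge> 1" "n \<ge> d"
  shows "real (b n d) \<le> 16 * 2 ^ n * real n powr (- (1 / 2 ^ d))"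
proof -
  let ?A = "{card F | F. F \<subseteq> Pow {0..<n} \<and> \<not> (\<exists>B\<subseteq>F. set_bool_alg n d B)}"
  have "?A \<subseteq> card ` Pow (Pow {0..<n})" by blast
  hence "finite ?A" by (rule finite_subset) simp
  \<comment> \<open>The empty family is admissible, so the maximum is attained.\<close>
  moreover have "\<not> set_bool_alg n d {}" by (auto simp: set_bool_alg_def)
  hence "card ({} :: nat set set) \<in> ?A" by (intro CollectI exI[of _ "{}"]) auto
  hence "?A \<noteq> {}" by blast
  ultimately have "b n d \<in> ?A" unfolding b_def by (rule Max_in)
  then obtain F where F: "b n d = card F" "F \<subseteq> Pow {0..<n}" "\<not> (\<exists>B\<subseteq>F. set_bool_alg n d B)"
    by blast
  have "inj_on (vec_of_set n) F"
  proof (rule inj_onI)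
    fix X Y assume XY: "X \<in> F" "Y \<in> F" and eq: "vec_of_set n X = vec_of_set n Y"
    have "i \<in> X \<longleftrightarrow> i \<in> Y" if "i < n" for i
      using fun_cong[OF eq, of i] that by (auto simp: vec_of_set_def split: if_splits)
    thus "X = Y" using XY F(2) by fastforce
  qed
  hence "real (b n d) = real (card (vec_of_set n ` F))" by (simp add: F(1) card_image)
  also have "\<dots> \<le> 16 * real 2 powr (real n - 1 / 2 ^ (d - 1)) * real n powr (- (1 / 2 ^ d))"
  proof (rule card_bound_cube)
    show "vec_of_set n ` F \<subseteq> cube 2 n" by (auto simp: vec_of_set_def cube_def)
    show "\<not> has_alg d (vec_of_set n ` F)" using set_bool_alg_of_has_alg[OF F(2)] F(3) by blast
  qed (use assms in auto)
  also have "real 2 powr (real n - 1 / 2 ^ (d - 1)) \<le> 2 powr real n"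
    by (simp add: powr_le_cancel_iff)
  also have "2 powr real n = (2::real) ^ n" by (simp add: powr_realpow)
  finally show ?thesis by (simp add: mult_right_mono)
qed

theorem theorem2p5:
  shows "\<exists>K::real.
    (\<forall>k n d F. k \<ge> 2 \<longrightarrow> d \<ge> 1 \<longrightarrow> n \<ge> d \<longrightarrow> F \<subseteq> cube k n \<longrightarrow>
        \<not> (\<exists>B\<subseteq>F. bool_alg k n d B) \<longrightarrow>
        real (card F) \<le> K * real k powr (real n - 1 / 2 ^ (d - 1)) * real n powr (- (1 / 2 ^ d))) \<and>
    (\<forall>n d. d \<ge> 1 \<longrightarrow> n \<ge> d \<longrightarrow>
        real (b n d) \<le> K * 2 ^ n * real n powr (- (1 / 2 ^ d)))"
proof (intro exI[of _ 16] conjI allI impI)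
  fix k n d :: nat and F
  assume "k \<ge> 2" "d \<ge> 1" "n \<ge> d" "F \<subseteq> cube k n" "\<not> (\<exists>B\<subseteq>F. bool_alg k n d B)"
  thus "real (card F) \<le> 16 * real k powr (real n - 1 / 2 ^ (d - 1)) * real n powr (- (1 / 2 ^ d))"
    using bool_alg_of_has_alg by (intro card_bound_cube) blast+
next
  fix n d :: nat
  assume "d \<ge> 1" "n \<ge> d"
  thus "real (b n d) \<le> 16 * 2 ^ n * real n powr (- (1 / 2 ^ d))" by (rule b_bound)
qed

end
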